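(* For any composition $I$, one has $\Sigma\nabla S_I=-S_{I^*}$ in $\mathbf{R}^{\mathbf{N}}$, i.e. for every $n\ge 0$, $(\Sigma(\nabla S_I))(n)=-S_{I^*}(n)$.
   Context: A composition is a nonempty finite sequence $I=(i_1,\dots,i_k)$ of positive integers, with weight $|I|=i_1+\cdots+i_k$ and length $\ell(I)=k$. Compositions of weight $m$ are in bijection with subsets of $\{1,2,\dots,m-1\}$ via $(i_1,\dots,i_k)\mapsto\{i_1,\,i_1+i_2,\dots,\,i_1+\cdots+i_{k-1}\}$. The composition $I^*$ is the composition of weight $|I|$ whose associated subset is the complement in $\{1,\dots,|I|-1\}$ of the subset associated with $I$; e.g. $(1,1,2)^*=(3,1)$. For a composition $I=(i_1,\dots,i_k)$ and an integer $n\ge 0$ put $$S_I(n)=\sum_{n\ge n_1\ge n_2\ge\cdots\ge n_k\ge 1}\frac{1}{n_1^{i_1}\cdots n_k^{i_k}},$$ (so $S_I(0)=0$, an empty sum), and let $S_I$ denote the sequence $n\mapsto S_I(n)$. $\mathbf{R}^{\mathbf{N}}$ is the space of real-valued sequences $a=(a(n))_{n\ge 0}$. The linear operators $\Sigma$ and $\nabla$ on $\mathbf{R}^{\mathbf{N}}$ are defined by $$\Sigma a(n)=\sum_{i=0}^n a(i),\qquad \nabla a(n)=\sum_{i=0}^n\binom{n}{i}(-1)^i a(i).$$ $\Sigma\nabla$ denotes the composition: first apply $\nabla$, then $\Sigma$. *)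

theory Defs
  imports Complex_Main
begin

definition composition :: "nat list \<Rightarrow> bool" where
  "composition I \<longleftrightarrow> I \<noteq> [] \<and> (\<forall>i\<in>set I. 1 \<le> i)"

text \<open>The weight of a composition is \<open>sum_list I\<close>. The associated subset consists of the partial
  sums of \<open>I\<close>, with the full sum left out.\<close>

definition comp_set :: "nat list \<Rightarrow> nat set" where
  "comp_set I = {sum_list (take j I) | j. 1 \<le> j \<and> j < length I}"

text \<open>The definite description is meaningful whenever \<open>I\<close> is a composition; see \<open>comp_dual\<close> below.\<close>

definition comp_dual :: "nat list \<Rightarrow> nat list" where
  "comp_dual I = (THE J. composition J \<and> sum_list J = sum_list I \<and>
     comp_set J = {1..sum_list I - 1} - comp_set I)"

text \<open>The tuple \<open>(n\<^sub>1, \<dots>, n\<^sub>k)\<close> is the list \<open>ns\<close>, indexed from 0.\<close>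

definition S :: "nat list \<Rightarrow> nat \<Rightarrow> real" where
  "S I n = (\<Sum>ns | length ns = length I \<and> sorted_wrt (\<ge>) ns \<and> set ns \<subseteq> {1..n}.
     1 / (\<Prod>j<length I. real (ns ! j) ^ (I ! j)))"

definition Sigma_op :: "(nat \<Rightarrow> real) \<Rightarrow> nat \<Rightarrow> real" where
  "Sigma_op a n = (\<Sum>i=0..n. a i)"

definition nabla_op :: "(nat \<Rightarrow> real) \<Rightarrow> nat \<Rightarrow> real" where
  "nabla_op a n = (\<Sum>i=0..n. real (n choose i) * (-1) ^ i * a i)"

lemma finite_S_index:
  "finite {ns. length ns = length I \<and> sorted_wrt (\<ge>) ns \<and> set ns \<subseteq> {1..n::nat}}"
  by (rule finite_subset[OF _ finite_lists_length_eq[of "{1..n}" "length I"]]) auto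

lemma comp_set_single [simp]: "comp_set [i] = {}"
  by (auto simp: comp_set_def)

lemma comp_set_Cons:
  assumes "I \<noteq> []"
  shows "comp_set (i # I) = insert i ((+) i ` comp_set I)"
proof (intro set_eqI iffI)
  fix x assume "x \<in> comp_set (i # I)"
  then obtain j where j: "1 \<le> j" "j < length (i # I)" "x = sum_list (take j (i # I))"
    by (auto simp: comp_set_def)
  then obtain k where k: "j = Suc k" by (cases j) auto
  show "x \<in> insert i ((+) i ` comp_set I)"
  proof (cases "k = 0")
    case False
    then have "sum_list (take k I) \<in> comp_set I"
      using j k by (auto simp: comp_set_def intro!: exI[of _ k])
    then show ?thesis using j k by auto
  qed (use j k in auto)
next
  fix x assume "x \<in> insert i ((+) i ` comp_set I)"
  then consider "x = i" | j where "1 \<le> j" "j < length I" "x = i + sum_list (take j I)"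
    by (auto simp: comp_set_def)
  then show "x \<in> comp_set (i # I)"
  proof cases
    case 1
    then show ?thesis using assms by (auto simp: comp_set_def intro!: exI[of _ 1])
  next
    case 2
    then show ?thesis by (auto simp: comp_set_def intro!: exI[of _ "Suc j"])
  qed
qed

lemma comp_set_pos: "composition I \<Longrightarrow> x \<in> comp_set I \<Longrightarrow> 1 \<le> x"
  by (cases I) (auto simp: comp_set_def composition_def take_Cons')

lemma comp_set_inj:
  assumes "composition I" "composition J" "sum_list I = sum_list J" "comp_set I = comp_set J"
  shows "I = J"
  using assms
proof (induction I arbitrary: J)
  case Nil
  then show ?case by (simp add: composition_def)
next
  case (Cons i I)
  obtain j K where J: "J = j # K" using Cons.prems(2) by (cases J) (auto simp: composition_def)
  show ?case
  proof (cases "I = [] \<or> K = []")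
    case True
    then show ?thesis using Cons.prems J
      by (metis comp_set_Cons comp_set_single insert_not_empty sum_list.Cons sum_list.Nil add_0_right)
  next
    case False
    then have cI: "composition I" and cK: "composition K"
      using Cons.prems J by (auto simp: composition_def)
    have pI: "0 \<notin> comp_set I" and pK: "0 \<notin> comp_set K"
      using comp_set_pos[OF cI] comp_set_pos[OF cK] by fastforce+
    have eq: "insert i ((+) i ` comp_set I) = insert j ((+) j ` comp_set K)"
      using Cons.prems(4) False J by (simp add: comp_set_Cons)
    have "i \<in> insert j ((+) j ` comp_set K)" "j \<in> insert i ((+) i ` comp_set I)"
      using eq by auto
    then have ij: "i = j" by auto
    have "i \<notin> (+) i ` comp_set I" "i \<notin> (+) i ` comp_set K" using pI pK by auto
    then have "(+) i ` comp_set I = (+) i ` comp_set K"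
      using eq ij by (metis insert_ident)
    then have "comp_set I = comp_set K" by (simp add: inj_image_eq_iff)
    then show ?thesis using Cons.IH[OF cI cK] Cons.prems(3) J ij by simp
  qed
qed

lemma comp_set_surj:
  assumes "1 \<le> m" "A \<subseteq> {1..m - 1}"
  shows "\<exists>I. composition I \<and> sum_list I = m \<and> comp_set I = A"
  using assms
proof (induction m arbitrary: A rule: less_induct)
  case (less m)
  show ?case
  proof (cases "A = {}")
    case True
    then show ?thesis using less.prems by (intro exI[of _ "[m]"]) (auto simp: composition_def)
  next
    case False
    define i where "i = Min A"
    have fin: "finite A" using less.prems(2) finite_subset by blast
    have iA: "i \<in> A" and imin: "\<And>x. x \<in> A \<Longrightarrow> i \<le> x"
      using False fin by (auto simp: i_def)
    have i: "1 \<le> i" "i < m" using iA less.prems by fastforce+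
    define B where "B = {x. x \<noteq> 0 \<and> i + x \<in> A}"
    have "B \<subseteq> {1..m - i - 1}" using less.prems by (fastforce simp: B_def)
    then obtain J where J: "composition J" "sum_list J = m - i" "comp_set J = B"
      using less.IH[of "m - i" B] i by (metis diff_less less_le_trans zero_less_one zero_less_diff Suc_leI One_nat_def less_trans)
    have "A = insert i ((+) i ` B)"
    proof (intro set_eqI iffI)
      fix x assume x: "x \<in> A"
      show "x \<in> insert i ((+) i ` B)"
      proof (cases "x = i")
        case False
        then have "x - i \<in> B" "x = i + (x - i)" using x imin[OF x] by (auto simp: B_def)
        then show ?thesis by blast
      qed simp
    qed (use iA in \<open>auto simp: B_def\<close>)
    then show ?thesis using J i
      by (intro exI[of _ "i # J"]) (auto simp: comp_set_Cons composition_def)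
  qed
qed

lemma comp_dual:
  assumes "composition I"
  shows "composition (comp_dual I)"
    and "sum_list (comp_dual I) = sum_list I"
    and "comp_set (comp_dual I) = {1..sum_list I - 1} - comp_set I"
proof -
  have "1 \<le> sum_list I" using assms by (cases I) (auto simp: composition_def)
  then obtain J where J: "composition J \<and> sum_list J = sum_list I \<and>
      comp_set J = {1..sum_list I - 1} - comp_set I"
    using comp_set_surj[of "sum_list I" "{1..sum_list I - 1} - comp_set I"] by blast
  then have "composition (comp_dual I) \<and> sum_list (comp_dual I) = sum_list I \<and>
      comp_set (comp_dual I) = {1..sum_list I - 1} - comp_set I"
    unfolding comp_dual_def by (rule theI) (use J comp_set_inj[of _ J] in auto)
  then show "composition (comp_dual I)" "sum_list (comp_dual I) = sum_list I"
    "comp_set (comp_dual I) = {1..sum_list I - 1} - comp_set I" by auto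
qed

end

(* Let F_I(n) = S_I(n+1) - S_I(n). Since S_I(0) = 0, the claim is equivalent to nabla F_I = F_{I^*}.
   Raising the first part of I by one divides F_I(n) by n + 1, while prepending a part 1 replaces
   F_I by (Sigma F_I)(n) / (n + 1). Duality exchanges these two steps, and so does nabla, because
   nabla(a(n) / (n + 1)) = (Sigma nabla a)(n) / (n + 1) and nabla is an involution. *)

theory Submission
  imports Defs
begin

section \<open>The operators \<open>nabla_op\<close> and \<open>Sigma_op\<close>\<close>

lemma nabla_op_0: "nabla_op a 0 = a 0"
  by (simp add: nabla_op_def)

text \<open>Pascal's rule. With E the shift, \<open>nabla_op a n\<close> is ((1 - E)^n a)(0), and
  one factor 1 - E is split off here.\<close>

lemma nabla_op_Suc: "nabla_op a (Suc n) = nabla_op a n - nabla_op (\<lambda>i. a (Suc i)) n"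
proof -
  \<comment> \<open>The added term vanishes because n choose n + 1 is 0; both sums can then be split
    at index 0 over the same range.\<close>
  have "nabla_op a n = (\<Sum>i=0..Suc n. real (n choose i) * (-1) ^ i * a i)"
    by (simp add: nabla_op_def)
  also have "\<dots> = a 0 + (\<Sum>i=0..n. real (n choose Suc i) * (-1) ^ Suc i * a (Suc i))"
    by (subst sum.atLeast0_atMost_Suc_shift) simp
  finally have n: "nabla_op a n = \<dots>" .
  have "nabla_op a (Suc n) =
      a 0 + (\<Sum>i=0..n. real (Suc n choose Suc i) * (-1) ^ Suc i * a (Suc i))"
    unfolding nabla_op_def by (subst sum.atLeast0_atMost_Suc_shift) simp
  also have "(\<Sum>i=0..n. real (Suc n choose Suc i) * (-1) ^ Suc i * a (Suc i)) =
      (\<Sum>i=0..n. real (n choose Suc i) * (-1) ^ Suc i * a (Suc i)) -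
      nabla_op (\<lambda>i. a (Suc i)) n"
    unfolding nabla_op_def sum_subtractf[symmetric]
    by (rule sum.cong) (simp_all add: algebra_simps)
  finally show ?thesis using n by simp
qed

lemma nabla_op_diff: "nabla_op (\<lambda>i. a i - b i) n = nabla_op a n - nabla_op b n"
  by (simp add: nabla_op_def algebra_simps sum_subtractf)

text \<open>In the step to \<open>Suc n\<close> the recursion, used for both operators, leaves the
  value at n for the sequence shifted by one; hence \<open>a\<close> is arbitrary in the
  induction.\<close>

lemma nabla_op_involution: "nabla_op (nabla_op a) = a"
proof
  show "nabla_op (nabla_op a) n = a n" for n
    by (induction n arbitrary: a) (simp_all add: nabla_op_0 nabla_op_Suc nabla_op_diff)
qed

lemma Sigma_op_Suc: "Sigma_op a (Suc n) = Sigma_op a n + a (Suc n)"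
  by (simp add: Sigma_op_def)

text \<open>Hockey-stick summation of the binomials n choose i over n, carried out by Pascal's
  rule.\<close>

lemma Sigma_nabla_eq:
  "Sigma_op (nabla_op a) n = (\<Sum>i=0..n. real (Suc n choose Suc i) * (-1) ^ i * a i)"
proof (induction n)
  case 0
  then show ?case by (simp add: Sigma_op_def nabla_op_def)
next
  case (Suc n)
  have "(\<Sum>i=0..Suc n. real (Suc (Suc n) choose Suc i) * (-1) ^ i * a i) =
     (\<Sum>i=0..Suc n. real (Suc n choose Suc i) * (-1) ^ i * a i) + nabla_op a (Suc n)"
    unfolding nabla_op_def sum.distrib[symmetric]
    by (rule sum.cong) (simp_all add: algebra_simps)
  also have "(\<Sum>i=0..Suc n. real (Suc n choose Suc i) * (-1) ^ i * a i) =
     (\<Sum>i=0..n. real (Suc n choose Suc i) * (-1) ^ i * a i)"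
    by (simp only: sum.atLeast0_atMost_Suc) (simp add: binomial_eq_0)
  finally show ?case using Suc by (simp only: Sigma_op_Suc)
qed

text \<open>Absorption: (i + 1) times (n + 1 choose i + 1) equals (n + 1) times (n choose i). This
  trades the factor 1/(i + 1) inside the sum for 1/(n + 1) outside and leaves the binomials of
  \<open>Sigma_nabla_eq\<close>.\<close>

lemma nabla_op_divide:
  "nabla_op (\<lambda>i. a i / real (Suc i)) n = Sigma_op (nabla_op a) n / real (Suc n)"
proof -
  have "real (n choose i) * (-1) ^ i * (a i / real (Suc i)) =
      real (Suc n choose Suc i) * (-1) ^ i * a i / real (Suc n)" for i
  proof -
    have "real (Suc i) * real (Suc n choose Suc i) = real (Suc n) * real (n choose i)"
      by (metis Suc_times_binomial of_nat_mult)
    then have "real (n choose i) / real (Suc i) = real (Suc n choose Suc i) / real (Suc n)"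
      by (subst frac_eq_eq) (simp_all del: of_nat_Suc binomial_Suc_Suc add: mult.commute)
    then have "(real (n choose i) / real (Suc i)) * ((-1) ^ i * a i) =
        (real (Suc n choose Suc i) / real (Suc n)) * ((-1) ^ i * a i)"
      by (rule arg_cong)
    then show ?thesis
      by (simp only: times_divide_eq_left times_divide_eq_right mult.assoc)
  qed
  then show ?thesis
    unfolding Sigma_nabla_eq by (simp only: nabla_op_def sum_divide_distrib)
qed

section \<open>Nested sums and their differences\<close>

lemma S_Nil: "S [] n = 1"
proof -
  have "{ns. length ns = length ([] :: nat list) \<and> sorted_wrt (\<ge>) ns \<and> set ns \<subseteq> {1..n}} = {[]}"
    by auto
  then show ?thesis by (simp add: S_def)
qed

text \<open>The largest index m is split off; the remaining indices form an arbitrary admissible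
  tuple bounded by m.\<close>

lemma S_Cons: "S (i # I) n = (\<Sum>m=1..n. S I m / real m ^ i)"
proof -
  define A where "A m = {ns. length ns = length I \<and> sorted_wrt (\<ge>) ns \<and> set ns \<subseteq> {1..m}}" for m :: nat
  define g where "g ns = 1 / (\<Prod>j<length I. real (ns ! j) ^ (I ! j))" for ns
  have fin: "finite (A m)" for m
    unfolding A_def by (rule finite_S_index)
  have index: "{ns. length ns = length (i # I) \<and> sorted_wrt (\<ge>) ns \<and> set ns \<subseteq> {1..n}} =
      (\<lambda>(m, ns). m # ns) ` (SIGMA m:{1..n}. A m)" (is "?L = ?R")
  proof
    show "?L \<subseteq> ?R"
    proof
      fix ns assume "ns \<in> ?L"
      moreover from this obtain m ms where "ns = m # ms" by (cases ns) auto
      ultimately have "ns = (\<lambda>(m, ns). m # ns) (m, ms)" "(m, ms) \<in> (SIGMA m:{1..n}. A m)"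
        by (auto simp: A_def)
      then show "ns \<in> ?R" by (rule image_eqI)
    qed
    show "?R \<subseteq> ?L" by (fastforce simp: A_def)
  qed
  have inj: "inj_on (\<lambda>(m, ns). m # ns) (SIGMA m:{1..n}. A m)"
    by (auto simp: inj_on_def)
  have "S (i # I) n = (\<Sum>(m, ns)\<in>(SIGMA m:{1..n}. A m). g ns / real m ^ i)"
    unfolding S_def index sum.reindex[OF inj]
    by (rule sum.cong) (auto simp: g_def prod.lessThan_Suc_shift simp del: prod.lessThan_Suc)
  also have "\<dots> = (\<Sum>m=1..n. \<Sum>ns\<in>A m. g ns / real m ^ i)"
    by (subst sum.Sigma) (simp_all add: fin)
  also have "\<dots> = (\<Sum>m=1..n. S I m / real m ^ i)"
    by (simp add: S_def A_def g_def sum_divide_distrib)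
  finally show ?thesis .
qed

text \<open>This is F_I of the overview. By \<open>S_Cons\<close> it is a single term of the
  outermost sum.\<close>

definition S_diff :: "nat list \<Rightarrow> nat \<Rightarrow> real" where
  "S_diff I n = S I (Suc n) - S I n"

lemma S_0: "I \<noteq> [] \<Longrightarrow> S I 0 = 0"
  by (cases I) (simp_all add: S_Cons)

text \<open>The sum telescopes. For the empty list it would leave a boundary term, since
  \<open>S []\<close> is constantly 1.\<close>

lemma Sigma_S_diff: "I \<noteq> [] \<Longrightarrow> Sigma_op (S_diff I) n = S I (Suc n)"
  by (induction n) (simp_all add: Sigma_op_Suc S_diff_def S_0, simp add: Sigma_op_def S_diff_def S_0)

lemma S_diff_Cons: "S_diff (i # I) n = S I (Suc n) / real (Suc n) ^ i"
  by (simp add: S_diff_def S_Cons)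

lemma S_diff_Suc_Cons: "S_diff (Suc i # I) = (\<lambda>n. S_diff (i # I) n / real (Suc n))"
  by (simp add: S_diff_Cons fun_eq_iff mult.commute)

lemma S_diff_1_Cons:
  "I \<noteq> [] \<Longrightarrow> S_diff (1 # I) = (\<lambda>n. Sigma_op (S_diff I) n / real (Suc n))"
  by (simp add: S_diff_Cons fun_eq_iff Sigma_S_diff)

section \<open>Recursion for the dual composition\<close>

lemma comp_set_Suc_Cons: "comp_set (Suc i # I) = Suc ` comp_set (i # I)"
  by (cases "I = []") (auto simp: comp_set_Cons image_image)

lemma sum_list_composition: "composition I \<Longrightarrow> 1 \<le> sum_list I"
  by (cases I) (auto simp: composition_def)

text \<open>Replaces the definite description by a check of weight and subset, which determine a
  composition.\<close>

lemma comp_dual_eqI: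
  assumes "composition I" "composition J" "sum_list J = sum_list I"
    "comp_set J = {1..sum_list I - 1} - comp_set I"
  shows "comp_dual I = J"
  by (rule comp_set_inj) (use comp_dual[OF assms(1)] assms in auto)

text \<open>Raising the first part shifts all partial sums by one, so 1 is no longer among them. The
  complement is shifted too and gains 1, which is a new first part 1 of the dual.\<close>

lemma comp_dual_Suc_Cons:
  assumes "composition (i # I)"
  shows "comp_dual (Suc i # I) = 1 # comp_dual (i # I)"
proof (rule comp_dual_eqI)
  note dual = comp_dual[OF assms]
  have ne: "comp_dual (i # I) \<noteq> []" using dual(1) by (simp add: composition_def)
  show "composition (Suc i # I)" "composition (1 # comp_dual (i # I))"
    "sum_list (1 # comp_dual (i # I)) = sum_list (Suc i # I)"
    using assms dual by (auto simp: composition_def)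
  have m: "1 \<le> sum_list (i # I)" by (rule sum_list_composition[OF assms])
  have eq: "{1..sum_list (Suc i # I) - 1} = insert 1 (Suc ` {1..sum_list (i # I) - 1})"
    using m by auto
  \<comment> \<open>If 0 were in B, the right side would lose the point 1.\<close>
  have image: "insert 1 ((+) 1 ` (A - B)) = insert 1 (Suc ` A) - Suc ` B" if "0 \<notin> B" for A B
    using that by auto
  have "0 \<notin> comp_set (i # I)"
    using comp_set_pos[OF assms] by fastforce
  then show "comp_set (1 # comp_dual (i # I)) =
      {1..sum_list (Suc i # I) - 1} - comp_set (Suc i # I)"
    unfolding comp_set_Cons[OF ne] comp_set_Suc_Cons dual(3) eq by (rule image)
qed

text \<open>The mirror case: the new partial sum 1 is absent from the complement, which is therefore
  only shifted, as when the first part of the dual is raised.\<close>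

lemma comp_dual_1_Cons:
  assumes "composition I" "comp_dual I = j # J"
  shows "comp_dual (1 # I) = Suc j # J"
proof (rule comp_dual_eqI)
  note dual = comp_dual[OF assms(1), unfolded assms(2)]
  have ne: "I \<noteq> []" using assms by (simp add: composition_def)
  show "composition (1 # I)" "composition (Suc j # J)" "sum_list (Suc j # J) = sum_list (1 # I)"
    using assms dual by (auto simp: composition_def)
  have m: "1 \<le> sum_list I" by (rule sum_list_composition[OF assms(1)])
  have eq: "{1..sum_list (1 # I) - 1} = insert 1 (Suc ` {1..sum_list I - 1})"
    using m by auto
  have "Suc ` (A - B) = insert 1 (Suc ` A) - insert 1 ((+) 1 ` B)" if "0 \<notin> A" for A B
    using that by auto
  then show "comp_set (Suc j # J) = {1..sum_list (1 # I) - 1} - comp_set (1 # I)"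
    unfolding comp_set_Cons[OF ne] comp_set_Suc_Cons dual(3) eq by simp
qed

section \<open>Induction on the weight\<close>

lemma comp_dual_single_1: "comp_dual [1] = [1]"
  by (rule comp_dual_eqI) (simp_all add: composition_def)

text \<open>The sequence is 1/(n + 1). \<open>nabla_op\<close> sends the constant 1 to the indicator
  of 0, whose partial sums are again 1.\<close>

lemma nabla_S_diff_1: "nabla_op (S_diff [1]) = S_diff [1]"
proof
  fix n
  have "nabla_op (\<lambda>i. 1) i = (if i = 0 then 1 else 0)" for i
    by (cases i) (simp_all add: nabla_op_0 nabla_op_Suc)
  then have "Sigma_op (nabla_op (\<lambda>i. 1)) n = 1"
    by (simp add: Sigma_op_def)
  then show "nabla_op (S_diff [1]) n = S_diff [1] n"
    using nabla_op_divide[of "\<lambda>i. 1" n] by (simp add: S_diff_Cons[abs_def] S_Nil)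
qed

lemma nabla_S_diff: "composition I \<Longrightarrow> nabla_op (S_diff I) = S_diff (comp_dual I)"
proof (induction "sum_list I" arbitrary: I rule: less_induct)
  case less
  then obtain i K where I: "I = i # K" and i: "1 \<le> i"
    by (cases I) (auto simp: composition_def)
  \<comment> \<open>Every composition other than [1] arises from one of weight one less, by raising
    its first part or by prepending 1.\<close>
  consider j where "I = Suc j # K" "1 \<le> j" | "I = 1 # K" "K \<noteq> []" | "I = [1]"
  proof (cases "i = 1")
    case True
    then show ?thesis using I that(2,3) by blast
  next
    case False
    then show ?thesis using I i that(1)[of "i - 1"] by simp
  qed
  then show ?case
  proof cases
    case (1 j)
    have c: "composition (j # K)" using less.prems 1 by (auto simp: composition_def)
    have "nabla_op (S_diff (j # K)) = S_diff (comp_dual (j # K))"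
      using less.hyps[OF _ c] 1 by simp
    moreover have ne: "comp_dual (j # K) \<noteq> []"
      using comp_dual(1)[OF c] by (simp add: composition_def)
    ultimately show ?thesis
      unfolding 1(1) comp_dual_Suc_Cons[OF c] S_diff_Suc_Cons
      by (simp only: S_diff_1_Cons[OF ne] nabla_op_divide[abs_def])
  next
    case 2
    have c: "composition K" using less.prems 2 by (auto simp: composition_def)
    have IH: "nabla_op (S_diff K) = S_diff (comp_dual K)"
      using less.hyps[OF _ c] 2 by simp
    obtain j J where J: "comp_dual K = j # J"
      using comp_dual(1)[OF c] by (cases "comp_dual K") (auto simp: composition_def)
    \<comment> \<open>Here the division by n + 1 sits on the dual side, so
      \<open>nabla_op_divide\<close> is applied there and the involution carries the result back to
      I.\<close>
    have "S_diff I = nabla_op (S_diff (comp_dual I))"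
      unfolding 2(1) comp_dual_1_Cons[OF c J] S_diff_Suc_Cons S_diff_1_Cons[OF 2(2)]
        nabla_op_divide[abs_def] J[symmetric] IH[symmetric] nabla_op_involution ..
    then show ?thesis by (simp add: nabla_op_involution)
  next
    case 3
    then show ?thesis using nabla_S_diff_1 comp_dual_single_1 by simp
  qed
qed

theorem theorem6p4:
  fixes I :: "nat list"
  assumes "composition I"
  shows "Sigma_op (nabla_op (S I)) = (\<lambda>n. - S (comp_dual I) n)"
proof
  fix n
  have ne: "I \<noteq> []" "comp_dual I \<noteq> []"
    using assms comp_dual(1)[OF assms] by (auto simp: composition_def)
  show "Sigma_op (nabla_op (S I)) n = - S (comp_dual I) n"
  proof (induction n)
    case 0
    then show ?case using ne by (simp add: Sigma_op_def nabla_op_0 S_0)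
  next
    case (Suc n)
    \<comment> \<open>The left side of the claim grows by this amount from n to n + 1; by
      \<open>nabla_S_diff\<close> it is also the growth of the right side.\<close>
    have "nabla_op (S I) (Suc n) = - nabla_op (S_diff I) n"
      by (simp add: nabla_op_Suc S_diff_def[abs_def] nabla_op_diff)
    then show ?case
      using Suc by (simp add: Sigma_op_Suc nabla_S_diff[OF assms]) (simp add: S_diff_def)
  qed
qed

end
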